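(* Let $\Omega$, $v$, $X$, $\Omega^\pm(0)$, $\Sigma(0)$, $\Sigma(t)$ and $R$ be as in the context, and let $\phi^0\in C^2(\bar\Omega;\mathbb{R})$ satisfy $\phi^0>0$ on $\Omega^+(0)$, $\phi^0<0$ on $\Omega^-(0)$, $\{x\in\Omega \mid \phi^0(x)=0\}=\Sigma(0)$ and $\frac23<|\nabla\phi^0|<\frac43$ on $\Sigma(0)$. Let $\phi:\Theta\to\mathbb{R}$ be the local-in-space $C^2$-solution on the tubular neighborhood $\Theta$ of $\{\Sigma(t)\}_{t\ge0}$, and let $\tilde\phi:[0,\infty)\times\bar\Omega\to\mathbb{R}$ be the continuous viscosity solution on the whole domain, both as described in the context. Let $T>0$ be arbitrary and let $\Gamma_T$ be the set defined in the context (which contains the $[0,T]$-part of a tubular neighborhood of $\{\Sigma(t)\}_{0\le t\le T}$). Then $$\phi\equiv\tilde\phi\quad\text{on }\Gamma_T .$$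
   Context: Domain and velocity. $\Omega\subset\mathbb{R}^3$ is a bounded connected open set; $\nabla$ is the gradient in $x$ and $(\nabla v)_{ij}=\partial v_i/\partial x_j$. $v$ satisfies: (H1) $v\in C^0([0,\infty)\times\bar\Omega;\mathbb{R}^3)\cap C^1([0,\infty)\times\Omega;\mathbb{R}^3)$ is locally Lipschitz in $x\in\bar\Omega$ (for every $(t_0,x_0)$ there are $\delta,L>0$ with $|v(t,x)-v(t,\bar x)|\le L|x-\bar x|$ for $t\ge0$, $|t-t_0|<\delta$, and $x,\bar x\in\bar\Omega$ within distance $\delta$ of $x_0$); $v$ is three times partially differentiable in $x$; all of the partial derivatives of $v$ belong to $C^0([0,\infty)\times\Omega;\mathbb{R}^3)$; (H2) $\pm v(s,x)\in T_{\partial\Omega}(x)$ for all $s\in[0,\infty)$, $x\in\partial\Omega$, where for closed $K\subset\mathbb{R}^d$ and $x\in K$, $T_K(x):=\{z\in\mathbb{R}^d \mid \liminf_{h\to0+}h^{-1}\mathrm{dist}(x+hz,K)=0\}$; (H3) $|\partial v_i/\partial x_j|$ ($i,j=1,2,3$) are bounded on $[0,\infty)\times\Omega$. Flow. For each $(\tau,\xi)\in[0,\infty)\times\bar\Omega$ the ODE $x'(s)=v(s,x(s))$, $x(\tau)=\xi$ has a unique solution on $[0,\infty)$ staying in $\bar\Omega$, whose value at $s$ is denoted $X(s,\tau,\xi)$; $\bar\Omega,\partial\Omega,\Omega$ are invariant under this flow. Initial configuration. $\Omega^+(0)\subsetneq\Omega$ is a connected open set with $\partial\Omega^+(0)\cap\partial\Omega=\emptyset$;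 $\Omega^-(0):=\Omega\setminus\overline{\Omega^+(0)}$ is also connected; $\Sigma(0):=\partial\Omega^+(0)=\partial\Omega^+(0)\cap\partial\Omega^-(0)\subset\Omega$ is a closed (compact, without boundary) $C^2$-smooth surface. For $t\ge0$, $\Sigma(t):=X(t,0,\Sigma(0))$, so $\Sigma(t)\subset\Omega$. Tubular neighborhood. $\Sigma_\varepsilon(t)$ denotes the open $\varepsilon$-neighborhood of $\Sigma(t)$ in $\mathbb{R}^3$ (only $\varepsilon$ with $\Sigma_\varepsilon(t)\subset\Omega$ are considered). A set $\Theta\subset[0,\infty)\times\Omega$ is a tubular neighborhood of $\{\Sigma(t)\}_{t\ge0}$ if it contains $\bigcup_{t\ge0}(\{t\}\times\Sigma(t))$ and there is a nonincreasing $\varepsilon:[0,\infty)\to\mathbb{R}_{>0}$ with $\{t\}\times\Sigma_{\varepsilon(t)}(t)\subset\Theta$ for all $t\ge0$. The cut-off nonlinearity $R$. For $\varepsilon>0$ let $K_\varepsilon\subset\bar\Omega$ be the intersection of $\bar\Omega$ with the $\varepsilon$-neighborhood of $\partial\Omega$. Fix a smooth function $\varepsilon:[0,\infty)\to\mathbb{R}_{>0}$ with $K_{3\varepsilon(t)}\cap\Sigma(t)=\emptyset$ for all $t\ge0$, a smooth function $\eta_1:[0,\infty)\times\bar\Omega\to[0,1]$ with $\eta_1(t,x)=1$ for $x\notin K_{3\varepsilon(t)}$ and $\eta_1(t,x)=0$ for $x\in K_{2\varepsilon(t)}$, and a smooth function $\eta_2:[0,\infty)\to[0,1]$ with $\eta_2(r)=1$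 for $\frac23\le r\le\frac43$, $\eta_2(r)=0$ for $r\le\frac13$ or $r\ge\frac53$, monotone on each of $[\frac13,\frac23]$ and $[\frac43,\frac53]$. Define $R(t,x,p):=\eta_1(t,x)\eta_2(|p|)\langle(\nabla v(t,x))\frac{p}{|p|},\frac{p}{|p|}\rangle$, understood as $0$ where $\eta_1(t,x)\eta_2(|p|)=0$. Let $V_0>0$ be a constant with $\sup|R|\le V_0$. The classical solution $\phi$. $\Theta$ is a tubular neighborhood of $\{\Sigma(t)\}_{t\ge0}$ for which the problem $$\partial_t\phi+v\cdot\nabla\phi=\phi\Big\langle(\nabla v)\frac{\nabla\phi}{|\nabla\phi|},\frac{\nabla\phi}{|\nabla\phi|}\Big\rangle\text{ in }\Theta,\qquad\phi(0,\cdot)=\phi^0\text{ on }\Theta|_{t=0}$$ has a unique $C^2$-solution $\phi:\Theta\to\mathbb{R}$; this solution satisfies $\{x\mid(t,x)\in\Theta,\ \phi(t,x)=0\}=\Sigma(t)$ for all $t\ge0$, and for all $t\ge0$, $x\in\Sigma(t)$ there is $\xi\in\Sigma(0)$ with $|\nabla\phi(t,x)|=|\nabla\phi^0(\xi)|$; moreover $\Theta$ is chosen so that $\eta_1(t,x)\eta_2(|\nabla\phi(t,x)|)\equiv1$ in $\Theta$. (Such $\Theta$ and $\phi$ exist.) Hence $\phi$ satisfies $\partial_t\phi+v\cdot\nabla\phi=\phi R(t,x,\nabla\phi)$ in $\Theta$. The viscosity solution $\tilde\phi$. $\tilde\phi\in C^0([0,\infty)\times\bar\Omega;\mathbb{R})$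 is the unique function such that, for every $T>0$, it is a viscosity solution of $\partial_t\phi+v\cdot\nabla\phi=\phi R(t,x,\nabla\phi)$ in $(0,T)\times\Omega$, with $\tilde\phi(0,x)=\phi^0(x)$ on $\Omega$ and $\tilde\phi(t,x)=\phi^0(X(0,t,x))$ on $[0,T)\times\partial\Omega$; it satisfies $\{x\in\Omega\mid\tilde\phi(t,x)=0\}=\Sigma(t)$ for all $t\ge0$. (Such a $\tilde\phi$ exists.) Viscosity solution is meant in the standard sense: for every $C^1$ function $\varphi$ and every point $(t_0,x_0)\in(0,T)\times\Omega$ at which $\tilde\phi-\varphi$ has a maximum (resp. minimum), $\partial_t\varphi+v\cdot\nabla\varphi-\tilde\phi R(t_0,x_0,\nabla\varphi)\le0$ (resp. $\ge0$) at $(t_0,x_0)$. The set $\Gamma_T$. Fix $T>0$ and write $\Theta_T:=\Theta|_{0\le t\le T}$. Put $\tilde R(t,x,p):=V_0-R(t,x,e^{V_0t}p)$ and let $C>0$ be a constant with $|\tilde R(t,x,p)-\tilde R(t,x,q)|\le C|p-q|$ and $|\tilde R(t,x,p)-\tilde R(s,y,p)|\le C(1+|p|)|(t,x)-(s,y)|$ for all $(t,x),(s,y)\in\Theta_T$, $p,q\in\mathbb{R}^3$ (such $C$ exists due to the conditions on $v$ and the definition of $R$). Let $\tilde\Theta\subset\Theta$ be another tubular neighborhood of $\{\Sigma(t)\}_{t\ge0}$ such that $\phi$ is defined on the closure of $\tilde\Theta$ (i.e. this closure is contained in $\Theta$), and put $\tilde\Theta_T:=\tilde\Theta|_{0\le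 t\le T}$. Let $w(t,x):=e^{-V_0t}\phi(t,x)$, let $\alpha>0$ be a constant with $\alpha-2V_0-C\sup_{\tilde\Theta_T}|\nabla w|>0$, and let $\bar u(t,x):=e^{\alpha t}w(t,x)$; regard $w$ and $\bar u$ as functions on the closure of $\tilde\Theta$. For a constant $m_0>0$ define $$A_m:=\{(t,x)\in[0,T]\times\Omega \mid \bar u(t,x)=m\}\ (-m_0\le m\le m_0),\qquad\Gamma_T:=\bigcup_{-m_0\le m\le m_0}A_m,$$ where $m_0$ (depending on $T$ in general) is chosen small enough that $\Gamma_T\subset\tilde\Theta_T$, $\partial\Gamma_T\setminus\Gamma_T|_{t=0,T}=(A_{m_0}\cup A_{-m_0})|_{0<t<T}$, and $\Gamma_T$ contains the $[0,T]$-part of a tubular neighborhood of $\{\Sigma(t)\}_{0\le t\le T}$ (such $m_0$ exists because $\nabla\bar u\neq0$ near $\bigcup_{0\le t\le T}(\{t\}\times\Sigma(t))$).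
   Formalization: The tubular neighborhoods Θ and Θ̃ are assumed to be relatively open in [0,∞)×Ω; without this, isolated points of Θ̃ (for instance at t=T) could lie in Γ_T and the claim can fail there. *)

theory Defs
  imports "HOL-Analysis.Analysis"
begin

text \<open>Functions of time and space take a pair \<open>(t, x)\<close>.\<close>
type_synonym spacetime = "real \<times> (real^3)"

section \<open>Function spaces\<close>

text \<open>
  Derivatives up to order \<open>k\<close> exist on \<open>U\<close> (taken within \<open>U\<close>) and all of them extend
  continuously to \<open>D\<close>, where \<open>U \<subseteq> D \<subseteq> closure U\<close>; the function itself is continuous on \<open>D\<close>.
  For \<open>U = D\<close> open this is \<open>C\<^sup>k(U)\<close>; for \<open>U = D\<close> relatively open in \<open>[0,\<infinity>) \<times> \<real>\<^sup>3\<close> the time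
  derivative at \<open>t = 0\<close> is one-sided; for \<open>U\<close> open and \<open>D = closure U\<close> it is the usual space
  \<open>C\<^sup>k\<close> of the closure of \<open>U\<close>.  In the second equation \<open>g b\<close> is the derivative of \<open>f\<close> in the
  direction of the basis vector \<open>b\<close>.
\<close>
primrec Ck_upto :: "nat \<Rightarrow> 'a::euclidean_space set \<Rightarrow> 'a set \<Rightarrow> ('a \<Rightarrow> 'b::real_normed_vector) \<Rightarrow> bool" where
  "Ck_upto 0 U D f \<longleftrightarrow> continuous_on D f"
| "Ck_upto (Suc k) U D f \<longleftrightarrow> continuous_on D f \<and>
     (\<exists>g. (\<forall>x\<in>U. (f has_derivative (\<lambda>h. \<Sum>b\<in>Basis. (h \<bullet> b) *\<^sub>R g b x)) (at x within U)) \<and>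
          (\<forall>b\<in>Basis. Ck_upto k U D (g b)))"

abbreviation Ck_on :: "nat \<Rightarrow> 'a::euclidean_space set \<Rightarrow> ('a \<Rightarrow> 'b::real_normed_vector) \<Rightarrow> bool" where
  "Ck_on k U f \<equiv> Ck_upto k U U f"

definition smooth_upto :: "'a::euclidean_space set \<Rightarrow> 'a set \<Rightarrow> ('a \<Rightarrow> 'b::real_normed_vector) \<Rightarrow> bool" where
  "smooth_upto U D f \<longleftrightarrow> (\<forall>k. Ck_upto k U D f)"

text \<open>All iterated partial derivatives in \<open>x\<close> up to order \<open>k\<close> exist and are continuous on \<open>D\<close>.\<close>
primrec Ckx_on :: "nat \<Rightarrow> spacetime set \<Rightarrow> (spacetime \<Rightarrow> 'b::real_normed_vector) \<Rightarrow> bool" where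
  "Ckx_on 0 D f \<longleftrightarrow> continuous_on D f"
| "Ckx_on (Suc k) D f \<longleftrightarrow> continuous_on D f \<and>
     (\<forall>i. \<exists>g. (\<forall>(t, x)\<in>D. ((\<lambda>h. f (t, x + h *\<^sub>R axis i 1)) has_vector_derivative g (t, x)) (at 0)) \<and>
          Ckx_on k D g)"

section \<open>Differential operators\<close>

definition grad :: "(real^3 \<Rightarrow> real) \<Rightarrow> real^3 \<Rightarrow> real^3" where
  "grad f x = (\<chi> i. frechet_derivative f (at x) (axis i 1))"

definition gradx :: "(spacetime \<Rightarrow> real) \<Rightarrow> spacetime \<Rightarrow> real^3" where
  "gradx f = (\<lambda>(t, x). grad (\<lambda>y. f (t, y)) x)"

text \<open>Two-sided for \<open>t > 0\<close>, one-sided for \<open>t = 0\<close>.\<close>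
definition dt :: "(spacetime \<Rightarrow> real) \<Rightarrow> spacetime \<Rightarrow> real" where
  "dt f = (\<lambda>(t, x). vector_derivative (\<lambda>s. f (s, x)) (at t within {0..}))"

definition jacx :: "(spacetime \<Rightarrow> real^3) \<Rightarrow> spacetime \<Rightarrow> real^3^3" where
  "jacx v = (\<lambda>(t, x). jacobian (\<lambda>y. v (t, y)) (at x))"

definition stretch :: "(spacetime \<Rightarrow> real^3) \<Rightarrow> spacetime \<Rightarrow> real^3 \<Rightarrow> real" where
  "stretch v z p = (jacx v z *v (p /\<^sub>R norm p)) \<bullet> (p /\<^sub>R norm p)"

section \<open>Velocity field and flow\<close>

definition tangent_cone :: "'a::euclidean_space set \<Rightarrow> 'a \<Rightarrow> 'a set" where
  "tangent_cone K x = {z. Liminf (at_right 0) (\<lambda>h. ereal (infdist (x + h *\<^sub>R z) K / h)) = 0}"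

definition velocity_regular :: "(real^3) set \<Rightarrow> (spacetime \<Rightarrow> real^3) \<Rightarrow> bool" where
  "velocity_regular \<Omega> v \<longleftrightarrow>
     continuous_on ({0..} \<times> closure \<Omega>) v \<and> Ck_on 1 ({0..} \<times> \<Omega>) v \<and>
     (\<forall>t0\<ge>0. \<forall>x0\<in>closure \<Omega>. \<exists>\<delta>>0. \<exists>L>0. \<forall>t\<ge>0. \<forall>x\<in>closure \<Omega>. \<forall>y\<in>closure \<Omega>.
        \<bar>t - t0\<bar> < \<delta> \<and> dist x x0 \<le> \<delta> \<and> dist y x0 \<le> \<delta> \<longrightarrow> norm (v (t, x) - v (t, y)) \<le> L * norm (x - y)) \<and>
     Ckx_on 3 ({0..} \<times> \<Omega>) v"

definition velocity_tangential :: "(real^3) set \<Rightarrow> (spacetime \<Rightarrow> real^3) \<Rightarrow> bool" where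
  "velocity_tangential \<Omega> v \<longleftrightarrow> (\<forall>s\<ge>0. \<forall>x\<in>frontier \<Omega>.
     v (s, x) \<in> tangent_cone (frontier \<Omega>) x \<and> - v (s, x) \<in> tangent_cone (frontier \<Omega>) x)"

definition velocity_gradient_bounded :: "(real^3) set \<Rightarrow> (spacetime \<Rightarrow> real^3) \<Rightarrow> bool" where
  "velocity_gradient_bounded \<Omega> v \<longleftrightarrow> (\<exists>B. \<forall>z\<in>{0..} \<times> \<Omega>. \<forall>i j. \<bar>jacx v z $ i $ j\<bar> \<le> B)"

definition ode_solution ::
  "(real^3) set \<Rightarrow> (spacetime \<Rightarrow> real^3) \<Rightarrow> real \<Rightarrow> real^3 \<Rightarrow> (real \<Rightarrow> real^3) \<Rightarrow> bool" where
  "ode_solution \<Omega> v \<tau> \<xi> y \<longleftrightarrow> y \<tau> = \<xi> \<and>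
     (\<forall>s\<ge>0. y s \<in> closure \<Omega> \<and> (y has_vector_derivative v (s, y s)) (at s within {0..}))"

text \<open>\<open>X s \<tau> \<xi>\<close> is the position at time \<open>s\<close> of the particle that is at \<open>\<xi>\<close> at time \<open>\<tau>\<close>.\<close>
definition is_flow ::
  "(real^3) set \<Rightarrow> (spacetime \<Rightarrow> real^3) \<Rightarrow> (real \<Rightarrow> real \<Rightarrow> real^3 \<Rightarrow> real^3) \<Rightarrow> bool" where
  "is_flow \<Omega> v X \<longleftrightarrow>
     (\<forall>\<tau>\<ge>0. \<forall>\<xi>\<in>closure \<Omega>. ode_solution \<Omega> v \<tau> \<xi> (\<lambda>s. X s \<tau> \<xi>) \<and>
        (\<forall>y. ode_solution \<Omega> v \<tau> \<xi> y \<longrightarrow> (\<forall>s\<ge>0. y s = X s \<tau> \<xi>))) \<and>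
     (\<forall>S\<in>{closure \<Omega>, frontier \<Omega>, \<Omega>}. \<forall>\<tau>\<ge>0. \<forall>s\<ge>0. \<forall>\<xi>\<in>S. X s \<tau> \<xi> \<in> S)"

section \<open>Geometry\<close>

text \<open>A compact surface without boundary that is locally parametrized by regular
  \<open>C\<^sup>2\<close> homeomorphisms from open subsets of the plane.\<close>
definition closed_C2_surface :: "(real^3) set \<Rightarrow> bool" where
  "closed_C2_surface S \<longleftrightarrow> compact S \<and>
     (\<forall>p\<in>S. \<exists>W :: (real^2) set. \<exists>U f g. open W \<and> open U \<and> p \<in> U \<and>
        homeomorphism W (S \<inter> U) f g \<and> Ck_on 2 W f \<and>
        (\<forall>q\<in>W. inj (frechet_derivative f (at q))))"

definition initial_configuration :: "(real^3) set \<Rightarrow> (real^3) set \<Rightarrow> bool" where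
  "initial_configuration \<Omega> \<Omega>p \<longleftrightarrow>
     \<Omega>p \<subset> \<Omega> \<and> open \<Omega>p \<and> connected \<Omega>p \<and> frontier \<Omega>p \<inter> frontier \<Omega> = {} \<and>
     connected (\<Omega> - closure \<Omega>p) \<and>
     frontier \<Omega>p = frontier \<Omega>p \<inter> frontier (\<Omega> - closure \<Omega>p) \<and> frontier \<Omega>p \<subseteq> \<Omega> \<and>
     closed_C2_surface (frontier \<Omega>p)"

definition nbhd :: "real \<Rightarrow> 'a::metric_space set \<Rightarrow> 'a set" where
  "nbhd e S = (\<Union>y\<in>S. ball y e)"

definition boundary_layer :: "(real^3) set \<Rightarrow> real \<Rightarrow> (real^3) set" where
  "boundary_layer \<Omega> e = closure \<Omega> \<inter> nbhd e (frontier \<Omega>)"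

definition tubular_neighborhood ::
  "(real^3) set \<Rightarrow> (real \<Rightarrow> (real^3) set) \<Rightarrow> spacetime set \<Rightarrow> bool" where
  "tubular_neighborhood \<Omega> \<Sigma> N \<longleftrightarrow>
     N \<subseteq> {0..} \<times> \<Omega> \<and> (\<Union>t\<in>{0..}. {t} \<times> \<Sigma> t) \<subseteq> N \<and>
     (\<exists>e :: real \<Rightarrow> real. (\<forall>t\<ge>0. e t > 0) \<and> (\<forall>s\<ge>0. \<forall>t\<ge>s. e t \<le> e s) \<and>
        (\<forall>t\<ge>0. {t} \<times> nbhd (e t) (\<Sigma> t) \<subseteq> N))"

definition time_part :: "spacetime set \<Rightarrow> real set \<Rightarrow> spacetime set" where
  "time_part N I = {(t, x) \<in> N. t \<in> I}"

section \<open>Cut-off nonlinearity\<close>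

definition cutoffs ::
  "(real^3) set \<Rightarrow> (real \<Rightarrow> (real^3) set) \<Rightarrow> (real \<Rightarrow> real) \<Rightarrow> (spacetime \<Rightarrow> real) \<Rightarrow> (real \<Rightarrow> real) \<Rightarrow> bool" where
  "cutoffs \<Omega> \<Sigma> \<epsilon> \<eta>1 \<eta>2 \<longleftrightarrow>
     smooth_upto {0..} {0..} \<epsilon> \<and> (\<forall>t\<ge>0. \<epsilon> t > 0 \<and> boundary_layer \<Omega> (3 * \<epsilon> t) \<inter> \<Sigma> t = {}) \<and>
     smooth_upto ({0..} \<times> \<Omega>) ({0..} \<times> closure \<Omega>) \<eta>1 \<and>
     (\<forall>t\<ge>0. \<forall>x\<in>closure \<Omega>. \<eta>1 (t, x) \<in> {0..1} \<and>
        (x \<notin> boundary_layer \<Omega> (3 * \<epsilon> t) \<longrightarrow> \<eta>1 (t, x) = 1) \<and>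
        (x \<in> boundary_layer \<Omega> (2 * \<epsilon> t) \<longrightarrow> \<eta>1 (t, x) = 0)) \<and>
     smooth_upto {0..} {0..} \<eta>2 \<and>
     (\<forall>r\<ge>0. \<eta>2 r \<in> {0..1} \<and> (2/3 \<le> r \<and> r \<le> 4/3 \<longrightarrow> \<eta>2 r = 1) \<and>
        (r \<le> 1/3 \<or> r \<ge> 5/3 \<longrightarrow> \<eta>2 r = 0)) \<and>
     mono_on {1/3..2/3} \<eta>2 \<and> antimono_on {4/3..5/3} \<eta>2"

definition cutoff_R ::
  "(spacetime \<Rightarrow> real^3) \<Rightarrow> (spacetime \<Rightarrow> real) \<Rightarrow> (real \<Rightarrow> real) \<Rightarrow> spacetime \<Rightarrow> real^3 \<Rightarrow> real" where
  "cutoff_R v \<eta>1 \<eta>2 z p =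
     (if \<eta>1 z * \<eta>2 (norm p) = 0 then 0 else \<eta>1 z * \<eta>2 (norm p) * stretch v z p)"

section \<open>Classical and viscosity solutions\<close>

text \<open>The equation divides by \<open>\<bar>\<nabla>\<phi>\<bar>\<close>, so a solution has a nonvanishing gradient.\<close>
definition classical_solution ::
  "(spacetime \<Rightarrow> real^3) \<Rightarrow> (real^3 \<Rightarrow> real) \<Rightarrow> spacetime set \<Rightarrow> (spacetime \<Rightarrow> real) \<Rightarrow> bool" where
  "classical_solution v \<phi>0 \<Theta> \<phi> \<longleftrightarrow> Ck_on 2 \<Theta> \<phi> \<and>
     (\<forall>z\<in>\<Theta>. gradx \<phi> z \<noteq> 0 \<and> dt \<phi> z + v z \<bullet> gradx \<phi> z = \<phi> z * stretch v z (gradx \<phi> z)) \<and>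
     (\<forall>x. (0, x) \<in> \<Theta> \<longrightarrow> \<phi> (0, x) = \<phi>0 x)"

definition viscosity_solution ::
  "(real^3) set \<Rightarrow> (spacetime \<Rightarrow> real^3) \<Rightarrow> (spacetime \<Rightarrow> real^3 \<Rightarrow> real) \<Rightarrow> real
     \<Rightarrow> (spacetime \<Rightarrow> real) \<Rightarrow> bool" where
  "viscosity_solution \<Omega> v R T f \<longleftrightarrow>
     (\<forall>\<psi>. Ck_on 1 ({0<..<T} \<times> \<Omega>) \<psi> \<longrightarrow> (\<forall>z\<in>{0<..<T} \<times> \<Omega>.
        ((\<forall>z'\<in>{0<..<T} \<times> \<Omega>. f z' - \<psi> z' \<le> f z - \<psi> z) \<longrightarrow>
           dt \<psi> z + v z \<bullet> gradx \<psi> z - f z * R z (gradx \<psi> z) \<le> 0) \<and>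
        ((\<forall>z'\<in>{0<..<T} \<times> \<Omega>. f z' - \<psi> z' \<ge> f z - \<psi> z) \<longrightarrow>
           dt \<psi> z + v z \<bullet> gradx \<psi> z - f z * R z (gradx \<psi> z) \<ge> 0)))"

definition global_viscosity_problem ::
  "(real^3) set \<Rightarrow> (spacetime \<Rightarrow> real^3) \<Rightarrow> (real \<Rightarrow> real \<Rightarrow> real^3 \<Rightarrow> real^3)
     \<Rightarrow> (spacetime \<Rightarrow> real^3 \<Rightarrow> real) \<Rightarrow> (real^3 \<Rightarrow> real) \<Rightarrow> (spacetime \<Rightarrow> real) \<Rightarrow> bool" where
  "global_viscosity_problem \<Omega> v X R \<phi>0 f \<longleftrightarrow>
     continuous_on ({0..} \<times> closure \<Omega>) f \<and>
     (\<forall>T>0. viscosity_solution \<Omega> v R T f \<and> (\<forall>x\<in>\<Omega>. f (0, x) = \<phi>0 x) \<and>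
        (\<forall>t\<in>{0..<T}. \<forall>x\<in>frontier \<Omega>. f (t, x) = \<phi>0 (X 0 t x)))"

section \<open>The set on which the two solutions are compared\<close>

text \<open>\<open>u\<close> is only meaningful on the closure of \<open>N\<close>, hence the level sets are taken there.\<close>
definition level_part ::
  "(real^3) set \<Rightarrow> spacetime set \<Rightarrow> (spacetime \<Rightarrow> real) \<Rightarrow> real \<Rightarrow> real \<Rightarrow> spacetime set" where
  "level_part \<Omega> N u T m = {z \<in> ({0..T} \<times> \<Omega>) \<inter> closure N. u z = m}"

end

theory Submission
  imports Defs
begin

text \<open>
  Relative to the flow of \<open>v\<close>, information travels with a speed at most a constant times \<open>\<bar>\<phi>\<bar>\<close>,
  so that it cannot enter the tube \<open>\<bar>u\<bar> \<le> m0\<close>, whose walls move inwards faster than that once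
  \<open>\<alpha>\<close> is large.  No knowledge of the viscosity solution \<open>f\<close> on the walls is therefore needed.
  Since \<open>\<phi>\<close> is \<open>C\<^sup>1\<close>, it can serve as a test function without doubling of variables: for
  \<open>P = K ((u / m0)\<^bsup>2n\<^esup> + (t / T)\<^bsup>n\<^esup>)\<close> and \<open>K\<close> a bound for \<open>e\<^bsup>-V0 t\<^esup> \<bar>f - \<phi>\<bar>\<close> on the tube,
  \<open>\<plusminus> e\<^bsup>-V0 t\<^esup> (f - \<phi>) - P\<close> is nonpositive at time \<open>0\<close>, at time \<open>T\<close> and on the walls, and a positive
  maximum in the interior contradicts the equation.  Letting \<open>n \<rightarrow> \<infinity>\<close> gives \<open>f = \<phi>\<close> inside.
\<close>

section \<open>Gradients\<close>

lemma Ck_on_1_gderivI: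
  assumes "\<And>x. x \<in> S \<Longrightarrow> GDERIV f x :> g x" and "continuous_on S g"
  shows "Ck_on 1 S f"
proof -
  have "(f has_derivative (\<lambda>h. \<Sum>b\<in>Basis. (h \<bullet> b) *\<^sub>R (g x \<bullet> b))) (at x within S)" if "x \<in> S" for x
  proof -
    have "(\<lambda>h. \<Sum>b\<in>Basis. (h \<bullet> b) *\<^sub>R (g x \<bullet> b)) = (\<lambda>h. h \<bullet> g x)"
      by (simp add: euclidean_inner[of _ "g x"])
    then show ?thesis
      using assms(1)[OF that] by (simp add: gderiv_def has_derivative_at_withinI)
  qed
  moreover have "continuous_on S (\<lambda>x. g x \<bullet> b)" for b
    using assms(2) by (intro continuous_intros)
  moreover have "continuous_on S f"
    by (meson assms(1) gderiv_def has_derivative_continuous continuous_at_imp_continuous_on)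
  ultimately show ?thesis
    by (auto intro!: exI[of _ "\<lambda>b x. g x \<bullet> b"])
qed

lemma Ck_on_Suc_gradient:
  fixes f :: "'a::euclidean_space \<Rightarrow> real"
  assumes "Ck_on (Suc k) S f"
  obtains g where "continuous_on S g"
    and "\<And>x. x \<in> S \<Longrightarrow> (f has_derivative (\<lambda>h. h \<bullet> g x)) (at x within S)"
proof -
  obtain g where g: "\<And>x. x \<in> S \<Longrightarrow>
      (f has_derivative (\<lambda>h. \<Sum>b\<in>Basis. (h \<bullet> b) *\<^sub>R g b x)) (at x within S)"
    and cont: "\<And>b. b \<in> Basis \<Longrightarrow> Ck_on k S (g b)"
    using assms by auto
  have "continuous_on S (g b)" if "b \<in> Basis" for b
    using cont[OF that] by (cases k) auto
  then have "continuous_on S (\<lambda>x. \<Sum>b\<in>Basis. g b x *\<^sub>R b)"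
    by (intro continuous_intros)
  moreover have "(f has_derivative (\<lambda>h. h \<bullet> (\<Sum>b\<in>Basis. g b x *\<^sub>R b))) (at x within S)"
    if "x \<in> S" for x
    using g[OF that] by (simp add: inner_sum_right mult.commute)
  ultimately show ?thesis
    by (rule that)
qed

text \<open>At \<open>t = 0\<close> the set \<open>N\<close> is not a neighbourhood of
  \<open>(t, x)\<close>, but its spatial slices are open, so the relative derivative still yields a
  full derivative in space.\<close>

lemma has_derivative_spatial_slice:
  fixes f :: "spacetime \<Rightarrow> real"
  assumes "open \<Omega>" and N: "openin (top_of_set ({0..} \<times> \<Omega>)) N" and "(t, x) \<in> N"
    and f: "(f has_derivative (\<lambda>h. h \<bullet> G)) (at (t, x) within N)"
  shows "((\<lambda>y. f (t, y)) has_derivative (\<lambda>h. h \<bullet> snd G)) (at x)"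
proof -
  obtain V where V: "open V" "N = ({0..} \<times> \<Omega>) \<inter> V"
    using N by (auto simp: openin_open)
  let ?Y = "\<Omega> \<inter> (\<lambda>y. (t, y)) -` V"
  have sub: "(\<lambda>y. (t, y)) ` ?Y \<subseteq> N" and x: "x \<in> ?Y"
    using \<open>(t, x) \<in> N\<close> by (auto simp: V)
  have "open ?Y"
    using \<open>open \<Omega>\<close> \<open>open V\<close> by (intro open_Int open_vimage continuous_intros)
  have "((\<lambda>y. f (t, y)) has_derivative (\<lambda>h. (0, h) \<bullet> G)) (at x within ?Y)"
    by (rule has_derivative_in_compose[where f = "\<lambda>y. (t, y)",
          OF _ has_derivative_subset[OF f sub]])
      (auto intro!: derivative_eq_intros)
  then show ?thesis
    by (simp add: at_within_open[OF x \<open>open ?Y\<close>] inner_prod_def)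
qed

lemma grad_eq:
  assumes "(f has_derivative (\<lambda>h. h \<bullet> G)) (at x)"
  shows "grad f x = G"
proof -
  have "frechet_derivative f (at x) = (\<lambda>h. h \<bullet> G)"
    by (rule frechet_derivative_at[OF assms, symmetric])
  then show ?thesis
    by (simp add: grad_def vec_eq_iff inner_axis')
qed

text \<open>For \<open>t > 0\<close> the one-sided filter in \<open>dt\<close> agrees with
  \<open>at t\<close>, so the chain rule along the coordinate lines applies.\<close>

lemma gderiv_imp_gradx_dt:
  assumes "GDERIV f (t, x) :> G" and "t > 0"
  shows "gradx f (t, x) = snd G" and "dt f (t, x) = fst G"
proof -
  have f: "(f has_derivative (\<lambda>h. h \<bullet> G)) (at (t, x))"
    using assms(1) by (simp add: gderiv_def)
  have "((\<lambda>y. f (t, y)) has_derivative (\<lambda>h. (0, h) \<bullet> G)) (at x)"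
    by (rule has_derivative_compose[where f = "\<lambda>y. (t, y)", OF _ f])
      (auto intro!: derivative_eq_intros)
  then show "gradx f (t, x) = snd G"
    by (simp add: gradx_def inner_prod_def grad_eq)
  have "((\<lambda>s. f (s, x)) has_derivative (\<lambda>h. (h, 0) \<bullet> G)) (at t)"
    by (rule has_derivative_compose[where f = "\<lambda>s. (s, x)", OF _ f])
      (auto intro!: derivative_eq_intros)
  then have "((\<lambda>s. f (s, x)) has_vector_derivative fst G) (at t)"
    by (simp add: has_vector_derivative_def inner_prod_def)
  moreover have "at t within {0..} = at t"
    using \<open>t > 0\<close> by (intro at_within_interior) simp
  ultimately show "dt f (t, x) = fst G"
    by (simp add: dt_def vector_derivative_at)
qed

section \<open>Local test functions\<close>

text \<open>The square of the positive part of \<open>1 - |x - z|^2 / r^2\<close> is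
  \<open>C^1\<close> across the edge of its support. Value 1 and gradient 0 at \<open>z\<close>
  ensure that multiplication by it changes neither value nor gradient of a function there.\<close>

lemma C1_bump:
  fixes z :: "'a::euclidean_space"
  assumes "r > 0"
  obtains \<kappa> G where "\<And>x. GDERIV \<kappa> x :> G x" "continuous_on UNIV G" "\<And>x. \<kappa> x \<in> {0..1}"
    "\<kappa> z = 1" "G z = 0" "\<And>x. x \<notin> ball z r \<Longrightarrow> \<kappa> x = 0 \<and> G x = 0"
proof -
  define b where "b = (\<lambda>x. 1 - inverse (r\<^sup>2) * ((x - z) \<bullet> (x - z)))"
  define \<kappa> where "\<kappa> = (\<lambda>x. (max 0 (b x))\<^sup>2)"
  define G where "G = (\<lambda>x. (2 * max 0 (b x)) *\<^sub>R (- 2 * inverse (r\<^sup>2)) *\<^sub>R (x - z))"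
  have square: "((\<lambda>s::real. (max 0 s)\<^sup>2) has_real_derivative 2 * max 0 s) (at s)" for s
  proof (cases s "0 :: real" rule: linorder_cases)
    case less
    have "((\<lambda>s::real. 0) has_real_derivative 2 * max 0 s) (at s)"
      using less by auto
    then show ?thesis
      by (rule has_field_derivative_transform_within_open[of _ _ _ "{..<0}"]) (use less in auto)
  next
    case equal
    have "((\<lambda>h. (max 0 h)\<^sup>2 / h) \<longlongrightarrow> 0) (at (0::real))"
    proof (rule Lim_null_comparison)
      show "\<forall>\<^sub>F h in at (0::real). norm ((max 0 h)\<^sup>2 / h) \<le> \<bar>h\<bar>"
        by (rule always_eventually) (auto simp: max_def power2_eq_square)
      show "(abs \<longlongrightarrow> 0) (at (0::real))"
        by (rule tendsto_eq_intros | simp)+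
    qed
    then show ?thesis
      using equal by (simp add: DERIV_def)
  next
    case greater
    have "((\<lambda>s::real. s\<^sup>2) has_real_derivative 2 * max 0 s) (at s)"
      using greater by (auto intro!: derivative_eq_intros)
    then show ?thesis
      by (rule has_field_derivative_transform_within_open[of _ _ _ "{0<..}"]) (use greater in auto)
  qed
  have b: "GDERIV b x :> (- 2 * inverse (r\<^sup>2)) *\<^sub>R (x - z)" for x
  proof -
    have "((\<lambda>x. (x - z) \<bullet> (x - z)) has_derivative (\<lambda>h. (x - z) \<bullet> h + h \<bullet> (x - z))) (at x)"
      by (rule derivative_eq_intros refl | simp)+
    then have "(b has_derivative (\<lambda>h. 0 - inverse (r\<^sup>2) * ((x - z) \<bullet> h + h \<bullet> (x - z)))) (at x)"
      unfolding b_def by (intro has_derivative_diff has_derivative_const has_derivative_mult_right)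
    then show ?thesis
      by (simp add: gderiv_def inner_commute mult.commute mult.left_commute)
  qed
  have "GDERIV \<kappa> x :> G x" for x
    unfolding \<kappa>_def G_def by (rule GDERIV_DERIV_compose[OF b square])
  moreover have "continuous_on UNIV G"
    unfolding G_def b_def by (intro continuous_intros) (use assms in auto)
  moreover have b_le: "b x \<le> 1" for x
    by (simp add: b_def)
  then have "\<kappa> x \<in> {0..1}" for x
    by (auto simp: \<kappa>_def max_def power_le_one)
  moreover have "\<kappa> z = 1" "G z = 0"
    by (simp_all add: \<kappa>_def G_def b_def)
  moreover have "\<kappa> x = 0 \<and> G x = 0" if "x \<notin> ball z r" for x
  proof -
    have "r\<^sup>2 \<le> (norm (x - z))\<^sup>2"
      using that assms by (intro power_mono) (auto simp: dist_norm norm_minus_commute)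
    then have "b x \<le> 0"
      using assms by (simp add: b_def field_simps power2_norm_eq_inner)
    then show ?thesis
      by (simp add: \<kappa>_def G_def max_def)
  qed
  ultimately show ?thesis
    by (rule that)
qed

text \<open>
  The test functions in \<open>viscosity_solution\<close> are global; a local one is blended with a bound
  of \<open>f\<close> by a bump function.  The sign \<open>\<sigma>\<close> covers sub- and supersolutions at once.
\<close>
lemma viscosity_solution_local_test:
  assumes visc: "viscosity_solution \<Omega> v R T f"
    and "open U" "z \<in> U" "U \<subseteq> {0<..<T} \<times> \<Omega>"
    and bound: "\<And>y. y \<in> {0<..<T} \<times> \<Omega> \<Longrightarrow> \<bar>f y\<bar> \<le> B"
    and \<psi>: "\<And>y. y \<in> U \<Longrightarrow> GDERIV \<psi> y :> g y" "continuous_on U g"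
    and \<sigma>: "\<sigma> \<in> {1, -1}"
    and touch: "\<And>y. y \<in> U \<Longrightarrow> \<sigma> * (f y - \<psi> y) \<le> 0" "f z = \<psi> z"
  shows "\<sigma> * (fst (g z) + v z \<bullet> snd (g z) - f z * R z (snd (g z))) \<le> 0"
proof -
  obtain r where r: "r > 0" "cball z r \<subseteq> U"
    using \<open>open U\<close> \<open>z \<in> U\<close> open_contains_cball by blast
  obtain \<kappa> G where \<kappa>: "\<And>x. GDERIV \<kappa> x :> G x" "continuous_on UNIV G" "\<And>x. \<kappa> x \<in> {0..1}"
    "\<kappa> z = 1" "G z = 0" "\<And>x. x \<notin> ball z r \<Longrightarrow> \<kappa> x = 0 \<and> G x = 0"
    using C1_bump[OF \<open>r > 0\<close>] by metis
  \<comment> \<open>A convex combination of \<open>\<psi>\<close> and the constant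
    \<open>\<sigma> * B\<close> with weight \<open>\<kappa>\<close>; by the choice of
    \<open>B\<close> the constant lies on the required side of \<open>f\<close>.\<close>
  define \<psi>' where "\<psi>' = (\<lambda>y. if y \<in> U then \<sigma> * B + \<kappa> y * (\<psi> y - \<sigma> * B) else \<sigma> * B)"
  define g' where "g' = (\<lambda>y. if y \<in> U then \<kappa> y *\<^sub>R g y + (\<psi> y - \<sigma> * B) *\<^sub>R G y else 0)"
  \<comment> \<open>As \<open>cball z r\<close> lies in \<open>U\<close>, the open sets
    \<open>U\<close> and \<open>?V\<close> cover the space. On \<open>?V\<close> the blend is
    constant, so regularity can be checked on each set separately.\<close>
  let ?V = "- cball z r"
  have inU: "GDERIV \<psi>' y :> g' y" if "y \<in> U" for y
  proof -
    have "GDERIV (\<lambda>y. \<sigma> * B + \<kappa> y * (\<psi> y - \<sigma> * B)) y :> 0 + (\<kappa> y *\<^sub>R (g y - 0) + (\<psi> y - \<sigma> * B) *\<^sub>R G y)"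
      by (intro GDERIV_add GDERIV_mult GDERIV_diff GDERIV_const \<kappa> \<psi> that)
    then have "GDERIV (\<lambda>y. \<sigma> * B + \<kappa> y * (\<psi> y - \<sigma> * B)) y :> g' y"
      using that by (simp add: g'_def)
    then show ?thesis
      unfolding gderiv_def \<psi>'_def
      by (rule has_derivative_transform_within_open[OF _ \<open>open U\<close> that]) simp
  qed
  have outV: "\<psi>' y = \<sigma> * B" "g' y = 0" if "y \<in> ?V" for y
    using \<kappa>(6)[of y] that by (auto simp: \<psi>'_def g'_def)
  have "GDERIV \<psi>' y :> g' y" for y
  proof (cases "y \<in> U")
    case False
    then have y: "y \<in> ?V"
      using r by auto
    have "GDERIV (\<lambda>_. \<sigma> * B) y :> g' y"
      using outV(2)[OF y] by (simp add: GDERIV_const)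
    then show ?thesis
      unfolding gderiv_def
      by (rule has_derivative_transform_within_open[where s = "?V"]) (use y outV(1) in auto)
  qed (rule inU)
  moreover have "continuous_on (U \<union> ?V) g'"
  proof (rule continuous_on_open_Un)
    have "continuous_on U \<psi>"
      by (meson \<psi>(1) gderiv_def has_derivative_continuous continuous_at_imp_continuous_on)
    moreover have "continuous_on U \<kappa>"
      by (meson \<kappa>(1) gderiv_def has_derivative_continuous continuous_at_imp_continuous_on)
    moreover have "continuous_on U G"
      using \<kappa>(2) continuous_on_subset by blast
    ultimately have "continuous_on U (\<lambda>y. \<kappa> y *\<^sub>R g y + (\<psi> y - \<sigma> * B) *\<^sub>R G y)"
      using \<psi>(2) by (intro continuous_intros)
    then show "continuous_on U g'"
      by (rule continuous_on_eq) (simp add: g'_def)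
    have "continuous_on ?V (\<lambda>_. 0 :: spacetime)"
      by simp
    then show "continuous_on ?V g'"
      by (rule continuous_on_eq) (simp only: outV)
  qed (use \<open>open U\<close> in auto)
  then have "continuous_on ({0<..<T} \<times> \<Omega>) g'"
    by (rule continuous_on_subset) (use r in auto)
  ultimately have "Ck_on 1 ({0<..<T} \<times> \<Omega>) \<psi>'"
    by (intro Ck_on_1_gderivI)
  moreover have z: "z \<in> {0<..<T} \<times> \<Omega>"
    using assms by auto
  moreover have "g' z = g z" "\<psi>' z = f z"
    using \<kappa> \<open>z \<in> U\<close> touch(2) by (simp_all add: g'_def \<psi>'_def)
  moreover have "gradx \<psi>' z = snd (g' z)" "dt \<psi>' z = fst (g' z)"
    using gderiv_imp_gradx_dt[of \<psi>' "fst z" "snd z" "g' z"] inU[OF \<open>z \<in> U\<close>] z by auto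
  \<comment> \<open>The gap is the same convex combination of two nonpositive gaps, so touching in
    \<open>U\<close> becomes a global extremum at \<open>z\<close>.\<close>
  moreover have "\<sigma> * (f y - \<psi>' y) \<le> 0" if y: "y \<in> {0<..<T} \<times> \<Omega>" for y
  proof -
    have sq: "\<sigma> * (\<sigma> * x) = x" for x :: real
      using \<sigma> by auto
    have le: "\<sigma> * f y - B \<le> 0"
      using bound[OF y] \<sigma> by auto
    show ?thesis
    proof (cases "y \<in> U")
      case True
      have "\<sigma> * (f y - \<psi>' y) = \<kappa> y * (\<sigma> * (f y - \<psi> y)) + (1 - \<kappa> y) * (\<sigma> * f y - \<sigma> * (\<sigma> * B))"
        using True by (simp add: \<psi>'_def algebra_simps)
      also have "\<dots> \<le> 0"
        unfolding sq using \<kappa>(3)[of y] le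
        by (intro add_nonpos_nonpos mult_nonneg_nonpos[of "\<kappa> y", OF _ touch(1)[OF True]]
            mult_nonneg_nonpos[of "1 - \<kappa> y"]) auto
      finally show ?thesis .
    next
      case False
      then show ?thesis
        using le by (simp add: \<psi>'_def right_diff_distrib sq)
    qed
  qed
  ultimately have touch': "\<forall>y\<in>{0<..<T} \<times> \<Omega>. \<sigma> * (f y - \<psi>' y) \<le> 0" and eq: "\<psi>' z = f z"
    and C1: "Ck_on 1 ({0<..<T} \<times> \<Omega>) \<psi>'"
    and D: "gradx \<psi>' z = snd (g z)" "dt \<psi>' z = fst (g z)"
    by auto
  consider "\<sigma> = 1" | "\<sigma> = -1"
    using \<sigma> by auto
  then show ?thesis
  proof cases
    case 1
    then have "\<forall>y\<in>{0<..<T} \<times> \<Omega>. f y - \<psi>' y \<le> f z - \<psi>' z"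
      using touch' eq by auto
    then have "dt \<psi>' z + v z \<bullet> gradx \<psi>' z - f z * R z (gradx \<psi>' z) \<le> 0"
      using visc C1 z unfolding viscosity_solution_def by blast
    then show ?thesis
      using 1 by (simp add: D)
  next
    case 2
    then have "\<forall>y\<in>{0<..<T} \<times> \<Omega>. f y - \<psi>' y \<ge> f z - \<psi>' z"
      using touch' eq by auto
    then have "dt \<psi>' z + v z \<bullet> gradx \<psi>' z - f z * R z (gradx \<psi>' z) \<ge> 0"
      using visc C1 z unfolding viscosity_solution_def by blast
    then show ?thesis
      using 2 by (simp add: D)
  qed
qed


section \<open>Comparison in a tube\<close>

text \<open>With \<open>\<beta> = \<alpha> - V0\<close> the first base is \<open>u / m\<close>. The
  even exponent treats both walls alike: for \<open>t \<ge> 0\<close> the value is at least 1 on the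
  walls and at \<open>t = T\<close>, while it tends to 0 as \<open>n\<close> grows wherever
  \<open>|u| < m\<close> and \<open>0 \<le> t < T\<close>.\<close>

definition tube_barrier :: "real \<Rightarrow> real \<Rightarrow> nat \<Rightarrow> real \<Rightarrow> (spacetime \<Rightarrow> real) \<Rightarrow> spacetime \<Rightarrow> real" where
  "tube_barrier T m n \<beta> \<phi> z = (exp (\<beta> * fst z) * \<phi> z / m) ^ (2 * n) + (fst z / T) ^ n"

lemma gderiv_time_compose:
  fixes z :: spacetime
  assumes "(k has_real_derivative D) (at (fst z))"
  shows "GDERIV (\<lambda>y. k (fst y)) z :> (D, 0)"
proof -
  have "GDERIV fst z :> (1, 0)"
    by (simp add: gderiv_def inner_prod_def has_derivative_fst)
  from GDERIV_DERIV_compose[OF this assms] show ?thesis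
    by simp
qed

text \<open>\<open>G + (\<beta> * \<phi> z, 0)\<close> is the gradient of
  \<open>exp (\<beta> * t) * \<phi>\<close> without its exponential factor, which goes into
  \<open>c\<close>. Thus the spatial part of the barrier gradient is parallel to that of
  \<open>\<phi>\<close>.\<close>

lemma gderiv_tube_barrier:
  fixes m \<beta> :: real and n :: nat
  assumes "GDERIV \<phi> z :> G" and "m \<noteq> 0" "T \<noteq> 0"
  defines "c \<equiv> 2 * n * (exp (\<beta> * fst z) * \<phi> z / m) ^ (2 * n - 1) * (exp (\<beta> * fst z) / m)"
  shows "GDERIV (tube_barrier T m n \<beta> \<phi>) z :>
    c *\<^sub>R (G + (\<beta> * \<phi> z, 0)) + (n * (fst z / T) ^ (n - 1) / T, 0)"
proof -
  have E: "GDERIV (\<lambda>y. exp (\<beta> * fst y)) z :> (\<beta> * exp (\<beta> * fst z), 0)"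
    by (rule gderiv_time_compose) (auto intro!: derivative_eq_intros)
  have t: "GDERIV (\<lambda>y. (fst y / T) ^ n) z :> (n * (fst z / T) ^ (n - 1) / T, 0)"
    using \<open>T \<noteq> 0\<close> by (intro gderiv_time_compose) (auto intro!: derivative_eq_intros)
  have "((\<lambda>s. (s / m) ^ (2 * n)) has_real_derivative 2 * n * (s / m) ^ (2 * n - 1) / m) (at s)" for s
    using \<open>m \<noteq> 0\<close> by (auto intro!: derivative_eq_intros)
  from GDERIV_add[OF GDERIV_DERIV_compose[OF GDERIV_mult[OF E assms(1)] this] t]
  show ?thesis
    unfolding tube_barrier_def[abs_def] c_def
    by (rule back_subst[where P = "\<lambda>D. GDERIV _ z :> D"]) (simp add: prod_eq_iff algebra_simps)
qed

lemma continuous_on_tube_barrier: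
  assumes "continuous_on S \<phi>" "m \<noteq> 0" "T \<noteq> 0"
  shows "continuous_on S (tube_barrier T m n \<beta> \<phi>)"
  unfolding tube_barrier_def[abs_def] using assms by (auto intro!: continuous_intros)

text \<open>If \<open>F z > 0\<close>, then \<open>\<phi>\<close>, shifted by barrier plus
  \<open>F z\<close> with weight \<open>exp (V0 * t)\<close> and sign \<open>\<sigma>\<close>,
  touches \<open>f\<close> at \<open>z\<close>. The viscosity inequality then forces a sum of
  nonnegative terms to be at most 0, although the one from \<open>(t / T)^n\<close> is
  positive.\<close>

lemma tube_comparison_interior_max:
  fixes f \<phi> :: "spacetime \<Rightarrow> real"
  assumes visc: "viscosity_solution \<Omega> v R T f"
    and U: "open U" "z \<in> U" "U \<subseteq> {0<..<T} \<times> \<Omega>"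
    and bound: "\<And>y. y \<in> {0<..<T} \<times> \<Omega> \<Longrightarrow> \<bar>f y\<bar> \<le> B"
    and \<phi>: "\<And>y. y \<in> U \<Longrightarrow> GDERIV \<phi> y :> g y" "continuous_on U g"
    and eqn: "fst (g z) + v z \<bullet> snd (g z) = \<phi> z * R z (snd (g z))"
    and V0: "\<And>p. \<bar>R z p\<bar> \<le> V0"
    and L: "\<And>p q. \<bar>R z p - R z q\<bar> \<le> L * norm (p - q)"
    and \<beta>: "\<beta> - V0 - L * norm (snd (g z)) \<ge> 0"
    and \<sigma>: "\<sigma> \<in> {1, -1}" and pos: "K > 0" "m > 0" "n > 0"
  defines "F \<equiv> \<lambda>y. \<sigma> * exp (- V0 * fst y) * (f y - \<phi> y) - K * tube_barrier T m n \<beta> \<phi> y"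
  assumes max: "\<And>y. y \<in> U \<Longrightarrow> F y \<le> F z"
  shows "F z \<le> 0"
proof (rule ccontr)
  assume "\<not> F z \<le> 0"
  define P where "P = (\<lambda>y. K * tube_barrier T m n \<beta> \<phi> y + F z)"
  define c where "c = (\<lambda>y. 2 * n * (exp (\<beta> * fst y) * \<phi> y / m) ^ (2 * n - 1) * (exp (\<beta> * fst y) / m))"
  define d where "d = (\<lambda>y::spacetime. n * (fst y / T) ^ (n - 1) / T)"
  define e where "e = (\<lambda>y::spacetime. exp (V0 * fst y))"
  \<comment> \<open>With this choice \<open>\<sigma> * (f - \<psi>)\<close> equals
    \<open>e * (F - F z)\<close>. Differentiating the weight \<open>e\<close> yields
    \<open>V0 * e * P\<close>, which dominates the contribution of \<open>R\<close> multiplied by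
    \<open>e * P\<close>.\<close>
  define \<psi> where "\<psi> = (\<lambda>y. \<phi> y + \<sigma> * (e y * P y))"
  define g' where "g' = (\<lambda>y. g y + \<sigma> *\<^sub>R (e y *\<^sub>R K *\<^sub>R (c y *\<^sub>R (g y + (\<beta> * \<phi> y, 0)) + (d y, 0))
    + P y *\<^sub>R (V0 * e y, 0)))"
  have T: "0 < fst z" "fst z < T"
    using U by auto
  have ss: "\<sigma> * (\<sigma> * x) = x" for x :: real
    using \<sigma> by auto
  have "GDERIV \<psi> y :> g' y" if "y \<in> U" for y
  proof -
    have "GDERIV e y :> (V0 * e y, 0)"
      unfolding e_def by (rule gderiv_time_compose) (auto intro!: derivative_eq_intros)
    moreover have "GDERIV P y :> K *\<^sub>R (c y *\<^sub>R (g y + (\<beta> * \<phi> y, 0)) + (d y, 0))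
        + tube_barrier T m n \<beta> \<phi> y *\<^sub>R 0 + 0"
      unfolding P_def c_def d_def
      using T pos by (intro GDERIV_add GDERIV_mult GDERIV_const gderiv_tube_barrier \<phi> that) auto
    ultimately have "GDERIV \<psi> y :> g y + (\<sigma> *\<^sub>R (e y *\<^sub>R (K *\<^sub>R (c y *\<^sub>R (g y + (\<beta> * \<phi> y, 0)) + (d y, 0))
        + tube_barrier T m n \<beta> \<phi> y *\<^sub>R 0 + 0)
        + P y *\<^sub>R (V0 * e y, 0)) + (e y * P y) *\<^sub>R 0)"
      unfolding \<psi>_def by (intro GDERIV_add GDERIV_mult GDERIV_const \<phi> that)
    then show ?thesis
      by (simp add: g'_def)
  qed
  moreover have "continuous_on U g'"
  proof -
    have \<phi>_cont: "continuous_on U \<phi>"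
      by (meson \<phi>(1) gderiv_def has_derivative_continuous continuous_at_imp_continuous_on)
    then have "continuous_on U P"
      unfolding P_def using T pos by (intro continuous_intros continuous_on_tube_barrier) auto
    then show ?thesis
      unfolding g'_def c_def d_def e_def using \<phi>_cont \<phi>(2) T pos
      by (intro continuous_intros) auto
  qed
  moreover have touch: "\<sigma> * (f y - \<psi> y) = e y * (F y - F z)" for y
    by (simp add: \<psi>_def P_def F_def e_def algebra_simps ss exp_minus)
  then have "\<sigma> * (f y - \<psi> y) \<le> 0" if "y \<in> U" for y
    using max[OF that] by (simp add: e_def mult_nonneg_nonpos)
  moreover have fz: "f z = \<psi> z"
    using touch[of z] \<sigma> by auto
  ultimately have *: "\<sigma> * (fst (g' z) + v z \<bullet> snd (g' z) - f z * R z (snd (g' z))) \<le> 0"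
    by (intro viscosity_solution_local_test[OF visc U bound _ _ \<sigma>])
  txt \<open>
    The difference \<open>r - s\<close> of the nonlinearities at the two gradients carries the factor \<open>\<phi> z\<close>
    rather than \<open>f z\<close>; hence it is absorbed by the part of the derivative of the barrier along
    the flow that comes from \<open>\<beta>\<close>.
  \<close>
  define p where "p = snd (g z)"
  define r where "r = R z p"
  define q where "q = snd (g' z)"
  define s where "s = R z q"
  \<comment> \<open>The barrier changes the spatial gradient only along \<open>p\<close>, so
    \<open>norm (p - q)\<close> is a multiple of \<open>norm p\<close>.\<close>
  have q: "q = p + (\<sigma> * (e z * K * c z)) *\<^sub>R p"
    by (simp add: q_def g'_def p_def algebra_simps)
  \<comment> \<open>The odd power in \<open>c z\<close> times \<open>\<phi> z\<close> completes to
    an even power.\<close>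
  have c\<phi>: "c z * \<phi> z \<ge> 0"
  proof -
    have "c z * \<phi> z = 2 * n * ((exp (\<beta> * fst z) * \<phi> z / m) ^ (2 * n - 1) * (exp (\<beta> * fst z) * \<phi> z / m))"
      by (simp add: c_def)
    also have "\<dots> = 2 * n * (exp (\<beta> * fst z) * \<phi> z / m) ^ (2 * n)"
      using pos by (subst power_minus_mult) auto
    finally show ?thesis
      by simp
  qed
  have "e z > 0"
    by (simp add: e_def)
  have "P z > 0"
    using \<open>\<not> F z \<le> 0\<close> pos T unfolding P_def tube_barrier_def
    by (intro add_nonneg_pos mult_nonneg_nonneg add_nonneg_nonneg) auto
  \<comment> \<open>The strict inequality at the end comes from this time derivative, positive
    because \<open>fst z > 0\<close>.\<close>
  have "d z > 0"
    using pos T by (simp add: d_def)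
  have "\<bar>r - s\<bar> \<le> L * norm (p - q)"
    unfolding r_def s_def by (rule L)
  also have "norm (p - q) = e z * K * \<bar>c z\<bar> * norm p"
    using \<sigma> \<open>e z > 0\<close> pos by (auto simp: q abs_mult)
  finally have "\<bar>r - s\<bar> \<le> L * (e z * K * \<bar>c z\<bar> * norm p)" .
  then have "\<bar>\<phi> z\<bar> * \<bar>r - s\<bar> \<le> \<bar>\<phi> z\<bar> * (L * (e z * K * \<bar>c z\<bar> * norm p))"
    by (intro mult_left_mono) auto
  also have "\<dots> = e z * (K * (\<bar>c z * \<phi> z\<bar> * (L * norm p)))"
    by (simp add: abs_mult)
  finally have "- (\<sigma> * (\<phi> z * (r - s))) \<le> e z * (K * ((c z * \<phi> z) * (L * norm p)))"
    using \<sigma> c\<phi> by (auto simp: abs_mult[symmetric])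
  \<comment> \<open>Inserting \<open>f z = \<phi> z + \<sigma> * (e z * P z)\<close> and the
    equation for \<open>\<phi>\<close> splits off \<open>\<phi> z * (r - s)\<close>; what remains
    pairs \<open>P z\<close> with \<open>V0 - s\<close> and the barrier with
    \<open>r + \<beta>\<close>.\<close>
  moreover have "\<sigma> * (\<phi> z * (r - s)) + e z * (P z * (V0 - s) + K * ((c z * \<phi> z) * (r + \<beta>) + d z)) \<le> 0"
  proof -
    have "fst (g' z) + v z \<bullet> q = \<phi> z * r
        + \<sigma> * (e z * (K * (c z * (\<phi> z * r + \<beta> * \<phi> z) + d z) + P z * V0))"
      unfolding q r_def p_def eqn[symmetric] by (simp add: g'_def algebra_simps)
    then have "\<sigma> * (\<phi> z * r + \<sigma> * (e z * (K * (c z * (\<phi> z * r + \<beta> * \<phi> z) + d z) + P z * V0))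
        - (\<phi> z + \<sigma> * (e z * P z)) * s) \<le> 0"
      using * unfolding fz q_def[symmetric] s_def[symmetric] by (simp add: \<psi>_def)
    then show ?thesis
      by (simp add: algebra_simps ss)
  qed
  ultimately have "e z * (P z * (V0 - s) + K * ((c z * \<phi> z) * (r + \<beta> - L * norm p) + d z)) \<le> 0"
    by (simp add: algebra_simps)
  moreover have "e z * (P z * (V0 - s) + K * ((c z * \<phi> z) * (r + \<beta> - L * norm p) + d z)) > 0"
  proof -
    have "V0 - s \<ge> 0" "r + \<beta> - L * norm p \<ge> 0"
      using V0[of p] V0[of q] \<beta> by (auto simp: r_def s_def p_def)
    then show ?thesis
      using \<open>e z > 0\<close> \<open>P z > 0\<close> \<open>d z > 0\<close> c\<phi> pos
      by (intro mult_pos_pos[of "e z"] add_nonneg_pos mult_nonneg_nonneg[of "P z"] mult_pos_pos[of K]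
          mult_nonneg_nonneg[of "c z * \<phi> z"]) auto
  qed
  ultimately show False
    by simp
qed

theorem theorem3p2:
  fixes \<Omega> \<Omega>p :: "(real^3) set"
    and v :: "spacetime \<Rightarrow> real^3"
    and X :: "real \<Rightarrow> real \<Rightarrow> real^3 \<Rightarrow> real^3"
    and \<Sigma> :: "real \<Rightarrow> (real^3) set"
    and \<epsilon> \<eta>2 :: "real \<Rightarrow> real"
    and \<eta>1 \<phi> \<phi>v w u :: "spacetime \<Rightarrow> real"
    and R R' :: "spacetime \<Rightarrow> real^3 \<Rightarrow> real"
    and \<phi>0 :: "real^3 \<Rightarrow> real"
    and \<Theta> \<Theta>' \<Gamma> :: "spacetime set"
    and A :: "real \<Rightarrow> spacetime set"
    and V0 C \<alpha> m0 T :: real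
  assumes domain: "open \<Omega>" "connected \<Omega>" "bounded \<Omega>"
    and velocity: "velocity_regular \<Omega> v" "velocity_tangential \<Omega> v" "velocity_gradient_bounded \<Omega> v"
    and flow: "is_flow \<Omega> v X"
    and initial: "initial_configuration \<Omega> \<Omega>p"
    and Sigma: "\<Sigma> = (\<lambda>t. X t 0 ` frontier \<Omega>p)"
    \<comment> \<open>the cut-off nonlinearity\<close>
    and cutoffs: "cutoffs \<Omega> \<Sigma> \<epsilon> \<eta>1 \<eta>2"
    and R: "R = cutoff_R v \<eta>1 \<eta>2"
    and V0: "V0 > 0" "\<forall>z\<in>{0..} \<times> closure \<Omega>. \<forall>p. \<bar>R z p\<bar> \<le> V0"
    \<comment> \<open>the initial function\<close>
    and phi0_C2: "Ck_upto 2 \<Omega> (closure \<Omega>) \<phi>0"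
    and phi0_sign: "\<forall>x\<in>\<Omega>p. \<phi>0 x > 0" "\<forall>x\<in>\<Omega> - closure \<Omega>p. \<phi>0 x < 0"
      "{x \<in> \<Omega>. \<phi>0 x = 0} = frontier \<Omega>p"
    and phi0_grad: "\<forall>x\<in>frontier \<Omega>p. 2/3 < norm (grad \<phi>0 x) \<and> norm (grad \<phi>0 x) < 4/3"
    \<comment> \<open>the classical solution\<close>
    and Theta: "tubular_neighborhood \<Omega> \<Sigma> \<Theta>" "openin (top_of_set ({0..} \<times> \<Omega>)) \<Theta>"
    and phi: "classical_solution v \<phi>0 \<Theta> \<phi>"
      "\<forall>\<psi>. classical_solution v \<phi>0 \<Theta> \<psi> \<longrightarrow> (\<forall>z\<in>\<Theta>. \<psi> z = \<phi> z)"
    and phi_zero: "\<forall>t\<ge>0. {x. (t, x) \<in> \<Theta> \<and> \<phi> (t, x) = 0} = \<Sigma> t"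
    and phi_grad: "\<forall>t\<ge>0. \<forall>x\<in>\<Sigma> t. \<exists>\<xi>\<in>\<Sigma> 0. norm (gradx \<phi> (t, x)) = norm (grad \<phi>0 \<xi>)"
    and phi_cutoff: "\<forall>z\<in>\<Theta>. \<eta>1 z * \<eta>2 (norm (gradx \<phi> z)) = 1"
    \<comment> \<open>the viscosity solution\<close>
    and phiv: "global_viscosity_problem \<Omega> v X R \<phi>0 \<phi>v"
      "\<forall>f. global_viscosity_problem \<Omega> v X R \<phi>0 f \<longrightarrow> (\<forall>z\<in>{0..} \<times> closure \<Omega>. f z = \<phi>v z)"
    and phiv_zero: "\<forall>t\<ge>0. {x \<in> \<Omega>. \<phi>v (t, x) = 0} = \<Sigma> t"
    \<comment> \<open>the comparison set\<close>
    and T: "T > 0"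
    and R': "R' = (\<lambda>(t, x) p. V0 - R (t, x) (exp (V0 * t) *\<^sub>R p))"
    and C: "C > 0"
      "\<forall>z\<in>time_part \<Theta> {0..T}. \<forall>p q. \<bar>R' z p - R' z q\<bar> \<le> C * norm (p - q)"
      "\<forall>z\<in>time_part \<Theta> {0..T}. \<forall>z'\<in>time_part \<Theta> {0..T}. \<forall>p.
         \<bar>R' z p - R' z' p\<bar> \<le> C * (1 + norm p) * norm (z - z')"
    and Theta': "tubular_neighborhood \<Omega> \<Sigma> \<Theta>'" "openin (top_of_set ({0..} \<times> \<Omega>)) \<Theta>'"
      "\<Theta>' \<subseteq> \<Theta>" "closure \<Theta>' \<subseteq> \<Theta>"
    and w: "w = (\<lambda>(t, x). exp (- V0 * t) * \<phi> (t, x))"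
    and alpha: "\<alpha> > 0" "\<alpha> - 2 * V0 - C * (SUP z\<in>time_part \<Theta>' {0..T}. norm (gradx w z)) > 0"
    and u: "u = (\<lambda>(t, x). exp (\<alpha> * t) * w (t, x))"
    and A: "A = level_part \<Omega> \<Theta>' u T"
    and Gamma: "\<Gamma> = (\<Union>m\<in>{-m0..m0}. A m)"
    and m0: "m0 > 0" "\<Gamma> \<subseteq> time_part \<Theta>' {0..T}"
      "frontier \<Gamma> - time_part \<Gamma> {0, T} = time_part (A m0 \<union> A (- m0)) {0<..<T}"
      "\<exists>N. tubular_neighborhood \<Omega> \<Sigma> N \<and> time_part N {0..T} \<subseteq> \<Gamma>"
  shows "\<forall>z\<in>\<Gamma>. \<phi> z = \<phi>v z"
proof -

  \<comment> \<open>The classical solution: gradients, equation and constants\<close>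
  define \<beta> where "\<beta> = \<alpha> - V0"
  obtain g where g_cont: "continuous_on \<Theta> g"
    and g: "\<And>z. z \<in> \<Theta> \<Longrightarrow> (\<phi> has_derivative (\<lambda>h. h \<bullet> g z)) (at z within \<Theta>)"
    using phi(1) Ck_on_Suc_gradient[of 1 \<Theta> \<phi>] unfolding classical_solution_def
    by (auto simp: numeral_2_eq_2 simp del: Ck_upto.simps)
  have \<phi>_cont: "continuous_on \<Theta> \<phi>"
    using g has_derivative_continuous continuous_on_eq_continuous_within by blast
  have u_eq: "u z = exp (\<beta> * fst z) * \<phi> z" for z
    by (cases z) (simp add: u w \<beta>_def left_diff_distrib exp_diff exp_minus divide_inverse mult.assoc)
  have u_cont: "continuous_on \<Theta> u"
    unfolding u_eq[abs_def] using \<phi>_cont by (intro continuous_intros)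
  have \<Theta>_sub: "\<Theta> \<subseteq> {0..} \<times> \<Omega>"
    using Theta(1) by (simp add: tubular_neighborhood_def)
  obtain V where V: "open V" "\<Theta> = ({0..} \<times> \<Omega>) \<inter> V"
    using Theta(2) by (auto simp: openin_open)
  obtain V' where V': "open V'" "\<Theta>' = ({0..} \<times> \<Omega>) \<inter> V'"
    using Theta'(2) by (auto simp: openin_open)

  have slice: "((\<lambda>y. \<phi> (t, y)) has_derivative (\<lambda>h. h \<bullet> snd (g (t, x)))) (at x)"
    if "(t, x) \<in> \<Theta>" for t x
    using has_derivative_spatial_slice[OF domain(1) Theta(2) that g[OF that]] .
  have gradx_\<phi>: "gradx \<phi> z = snd (g z)" if "z \<in> \<Theta>" for z
    using grad_eq[OF slice[of "fst z" "snd z"]] that by (cases z) (simp add: gradx_def)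
  have gradx_w: "gradx w z = exp (- V0 * fst z) *\<^sub>R snd (g z)" if "z \<in> \<Theta>" for z
  proof -
    obtain t x where z: "z = (t, x)"
      by (cases z)
    have "((\<lambda>y. w (t, y)) has_derivative (\<lambda>h. h \<bullet> (exp (- V0 * t) *\<^sub>R snd (g (t, x))))) (at x)"
      using has_derivative_mult_right[OF slice, of t x "exp (- V0 * t)"] that by (simp add: z w)
    from grad_eq[OF this] show ?thesis
      by (simp add: z gradx_def)
  qed
  \<comment> \<open>The cut-offs have product 1 on \<open>\<Theta>\<close>, so
    \<open>\<eta>2\<close> is nonzero at the norm of the gradient, whereas it vanishes from
    \<open>5/3\<close> on.\<close>
  have grad_bound: "norm (snd (g z)) \<le> 5/3" if "z \<in> \<Theta>" for z
  proof -
    have "\<eta>2 (norm (snd (g z))) \<noteq> 0"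
      using phi_cutoff that by (auto simp: gradx_\<phi>)
    then show ?thesis
      using cutoffs unfolding cutoffs_def by (meson linorder_le_cases norm_ge_zero)
  qed
  \<comment> \<open>At positive times relative openness of \<open>\<Theta>\<close> is openness in
    space-time, so the relative derivative is a full one.\<close>
  have gd: "GDERIV \<phi> z :> g z" if "z \<in> \<Theta>" "fst z > 0" for z
  proof -
    have "at z within \<Theta> = at z"
      using that V domain(1)
      by (intro at_within_open_subset[of _ "({0<..} \<times> \<Omega>) \<inter> V"] open_Int open_Times) auto
    then show ?thesis
      using g[OF that(1)] by (simp add: gderiv_def)
  qed
  have eqn: "fst (g z) + v z \<bullet> snd (g z) = \<phi> z * R z (snd (g z))" if "z \<in> \<Theta>" "fst z > 0" for z
  proof -
    have "dt \<phi> z = fst (g z)"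
      using gderiv_imp_gradx_dt(2)[of \<phi> "fst z" "snd z"] gd[OF that] that by simp
    moreover have "R z (snd (g z)) = stretch v z (snd (g z))"
      using phi_cutoff that(1) by (auto simp: R cutoff_R_def gradx_\<phi>)
    ultimately show ?thesis
      using phi(1) that(1) by (auto simp: classical_solution_def gradx_\<phi>)
  qed
  \<comment> \<open>Undoing the rescaling of the gradient in \<open>R'\<close> multiplies the
    Lipschitz constant by \<open>exp (- V0 * t)\<close>.\<close>
  have Lip: "\<bar>R z p - R z q\<bar> \<le> C * exp (- V0 * fst z) * norm (p - q)"
    if "z \<in> time_part \<Theta> {0..T}" for z p q
  proof -
    obtain t x where z: "z = (t, x)"
      by (cases z)
    have "R z y = V0 - R' z (exp (- V0 * t) *\<^sub>R y)" for y
      by (simp add: R' z flip: exp_add)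
    then have "\<bar>R z p - R z q\<bar> = \<bar>R' z (exp (- V0 * t) *\<^sub>R p) - R' z (exp (- V0 * t) *\<^sub>R q)\<bar>"
      by simp
    also have "\<dots> \<le> C * norm (exp (- V0 * t) *\<^sub>R p - exp (- V0 * t) *\<^sub>R q)"
      using C(2) that by blast
    finally show ?thesis
      by (simp add: z flip: scaleR_diff_right)
  qed
  \<comment> \<open>This is the condition on \<open>\<alpha>\<close>, since
    \<open>exp (- V0 * t)\<close> times the gradient of \<open>\<phi>\<close> is that of
    \<open>w\<close>. The bound \<open>5/3\<close> ensures that the supremum there is taken over a
    bounded set and is a true upper bound.\<close>
  have \<beta>: "\<beta> - V0 - C * exp (- V0 * fst z) * norm (snd (g z)) \<ge> 0" if "z \<in> time_part \<Theta>' {0..T}" for z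
  proof -
    have in\<Theta>: "y \<in> \<Theta> \<and> fst y \<ge> 0" if "y \<in> time_part \<Theta>' {0..T}" for y
      using that Theta'(3) by (auto simp: time_part_def)
    have "norm (gradx w y) \<le> 5/3" if "y \<in> time_part \<Theta>' {0..T}" for y
    proof -
      have "exp (- V0 * fst y) \<le> 1"
        using V0(1) in\<Theta>[OF that] by simp
      then have "exp (- V0 * fst y) * norm (snd (g y)) \<le> 1 * (5/3)"
        using grad_bound in\<Theta>[OF that] by (intro mult_mono) auto
      then show ?thesis
        using in\<Theta>[OF that] by (simp add: gradx_w)
    qed
    then have "norm (gradx w z) \<le> (SUP z\<in>time_part \<Theta>' {0..T}. norm (gradx w z))"
      using that by (intro cSUP_upper bdd_aboveI2)
    then have "C * norm (gradx w z) \<le> C * (SUP z\<in>time_part \<Theta>' {0..T}. norm (gradx w z))"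
      using C(1) by simp
    then show ?thesis
      using alpha(2) in\<Theta>[OF that] by (simp add: gradx_w \<beta>_def mult.assoc)
  qed

  \<comment> \<open>Compactness of the tube\<close>
  have \<Gamma>_iff: "z \<in> \<Gamma> \<longleftrightarrow> z \<in> closure \<Theta>' \<and> fst z \<in> {0..T} \<and> \<bar>u z\<bar> \<le> m0" for z
    using Theta'(4) \<Theta>_sub by (fastforce simp: Gamma A level_part_def abs_le_iff)
  have \<Gamma>_sub: "\<Gamma> \<subseteq> \<Theta>'" "\<Gamma> \<subseteq> \<Theta>"
    using m0(2) Theta'(3) by (auto simp: time_part_def)
  \<comment> \<open>The closure of \<open>\<Theta>'\<close> lies in \<open>\<Theta>\<close>, where
    \<open>u\<close> is continuous, so the condition on \<open>u\<close> is closed; boundedness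
    comes from \<open>\<Omega>\<close> and \<open>T\<close>.\<close>
  have "compact \<Gamma>"
  proof -
    have "bounded (closure \<Theta>' \<inter> ({0..T} \<times> UNIV))"
      using Theta'(4) \<Theta>_sub by (intro bounded_subset[OF bounded_Times[OF bounded_closed_interval domain(3)]]) auto
    then have "compact (closure \<Theta>' \<inter> ({0..T} \<times> UNIV))"
      by (simp add: compact_eq_bounded_closed closed_Int closed_Times)
    moreover have "closed {z \<in> closure \<Theta>' \<inter> ({0..T} \<times> UNIV). \<bar>u z\<bar> \<le> m0}"
      using Theta'(4) by (intro continuous_on_closed_Collect_le continuous_intros
          continuous_on_subset[OF u_cont] closed_Int closed_Times) auto
    ultimately have "compact ((closure \<Theta>' \<inter> ({0..T} \<times> UNIV)) \<inter> {z \<in> closure \<Theta>' \<inter> ({0..T} \<times> UNIV). \<bar>u z\<bar> \<le> m0})"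
      by (rule compact_Int_closed)
    also have "\<dots> = \<Gamma>"
      by (auto simp: \<Gamma>_iff)
    finally show ?thesis .
  qed

  \<comment> \<open>Bounds for the viscosity solution and for the difference\<close>
  have visc: "viscosity_solution \<Omega> v R T \<phi>v" and f0: "\<And>x. x \<in> \<Omega> \<Longrightarrow> \<phi>v (0, x) = \<phi>0 x"
    and f_cont: "continuous_on ({0..} \<times> closure \<Omega>) \<phi>v"
    using phiv(1) T by (auto simp: global_viscosity_problem_def)
  have "compact (\<phi>v ` ({0..T} \<times> closure \<Omega>))"
    using domain(3) by (intro compact_continuous_image continuous_on_subset[OF f_cont] compact_Times) auto
  then obtain B where "\<forall>y\<in>\<phi>v ` ({0..T} \<times> closure \<Omega>). norm y \<le> B"
    using compact_imp_bounded bounded_iff by blast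
  then have B: "\<bar>\<phi>v y\<bar> \<le> B" if "y \<in> {0<..<T} \<times> \<Omega>" for y
    using that closure_subset[of \<Omega>] by (cases y) auto
  have "{0..} \<times> \<Omega> \<subseteq> {0..} \<times> closure \<Omega>"
    by (intro Sigma_mono closure_subset) auto
  then have diff_cont: "continuous_on \<Gamma> \<phi>" "continuous_on \<Gamma> \<phi>v"
    using \<Gamma>_sub(2) \<Theta>_sub
    by (blast intro: continuous_on_subset[OF \<phi>_cont] continuous_on_subset[OF f_cont])+
  \<comment> \<open>The resulting bound \<open>K\<close> scales the barrier so that it dominates the
    weighted difference on the walls and at time \<open>T\<close>.\<close>
  have "compact ((\<lambda>z. exp (- V0 * fst z) * (\<phi>v z - \<phi> z)) ` \<Gamma>)"
    using \<open>compact \<Gamma>\<close> diff_cont by (intro compact_continuous_image continuous_intros)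
  then obtain K where "K > 0" and "\<forall>y\<in>(\<lambda>z. exp (- V0 * fst z) * (\<phi>v z - \<phi> z)) ` \<Gamma>. norm y \<le> K"
    using compact_imp_bounded bounded_pos by meson
  then have K: "\<bar>exp (- V0 * fst z) * (\<phi>v z - \<phi> z)\<bar> \<le> K" if "z \<in> \<Gamma>" for z
    using that by auto

  \<comment> \<open>Comparison of the difference with the barrier\<close>
  have below_barrier: "\<sigma> * exp (- V0 * fst z) * (\<phi>v z - \<phi> z) \<le> K * tube_barrier T m0 n \<beta> \<phi> z"
    if \<sigma>: "\<sigma> \<in> {1, -1}" and "n > 0" and "z \<in> \<Gamma>" for \<sigma> n z
  proof -
    define F where "F = (\<lambda>y. \<sigma> * exp (- V0 * fst y) * (\<phi>v y - \<phi> y) - K * tube_barrier T m0 n \<beta> \<phi> y)"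
    have "continuous_on \<Gamma> F"
      unfolding F_def using diff_cont T m0(1)
      by (intro continuous_intros continuous_on_tube_barrier) auto
    then obtain z1 where z1: "z1 \<in> \<Gamma>" "\<And>y. y \<in> \<Gamma> \<Longrightarrow> F y \<le> F z1"
      using continuous_attains_sup[OF \<open>compact \<Gamma>\<close>] \<open>z \<in> \<Gamma>\<close> by blast
    have "F z1 \<le> 0"
    proof (rule ccontr)
      assume "\<not> F z1 \<le> 0"
      have t1: "0 \<le> fst z1" "fst z1 \<le> T"
        using z1(1) by (auto simp: \<Gamma>_iff)
      \<comment> \<open>The weighted difference is at most \<open>K\<close>, so a positive
        \<open>F z1\<close> leaves room only for a barrier below 1; this excludes the walls and the
        final time.\<close>
      have bar_lt: "tube_barrier T m0 n \<beta> \<phi> z1 < 1"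
      proof (rule ccontr)
        assume "\<not> ?thesis"
        then have "K * 1 \<le> K * tube_barrier T m0 n \<beta> \<phi> z1"
          using \<open>K > 0\<close> by (intro mult_left_mono) auto
        moreover have "\<sigma> * exp (- V0 * fst z1) * (\<phi>v z1 - \<phi> z1) \<le> K"
          using K[OF z1(1)] \<sigma> by auto
        ultimately show False
          using \<open>\<not> F z1 \<le> 0\<close> by (simp add: F_def)
      qed
      have bar: "tube_barrier T m0 n \<beta> \<phi> z1 = (u z1 / m0) ^ (2 * n) + (fst z1 / T) ^ n"
        by (simp add: tube_barrier_def u_eq)
      have time_nonneg: "(fst z1 / T) ^ n \<ge> 0"
        using t1 T by (intro zero_le_power divide_nonneg_pos)
      have "fst z1 \<noteq> T"
        using bar_lt T unfolding bar by auto
      moreover have "\<bar>u z1\<bar> \<noteq> m0"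
      proof
        assume "\<bar>u z1\<bar> = m0"
        then have "(u z1 / m0)\<^sup>2 = 1"
          using m0(1) by (auto simp: power_divide abs_if split: if_splits)
        then have "(u z1 / m0) ^ (2 * n) = 1"
          by (simp add: power_mult)
        then show False
          using bar_lt time_nonneg unfolding bar by simp
      qed
      \<comment> \<open>Both solutions start from \<open>\<phi>0\<close>, so \<open>F\<close> is
        nonpositive at time 0.\<close>
      moreover have "fst z1 \<noteq> 0"
      proof
        assume "fst z1 = 0"
        then obtain x where x: "z1 = (0, x)"
          by (cases z1) auto
        then have "(0, x) \<in> \<Theta>" "x \<in> \<Omega>"
          using z1(1) \<Gamma>_sub \<Theta>_sub by auto
        then have "\<phi>v z1 = \<phi> z1"
          using phi(1) f0 by (simp add: x classical_solution_def)
        moreover have "tube_barrier T m0 n \<beta> \<phi> z1 \<ge> 0"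
          using time_nonneg unfolding bar by simp
        ultimately show False
          using \<open>\<not> F z1 \<le> 0\<close> \<open>K > 0\<close> by (simp add: F_def)
      qed
      ultimately have strict: "0 < fst z1" "fst z1 < T" "\<bar>u z1\<bar> < m0"
        using t1 z1(1) by (auto simp: \<Gamma>_iff)
      \<comment> \<open>\<open>U\<close> is a neighbourhood of \<open>z1\<close> in space-time that
        stays inside \<open>\<Gamma>\<close>, so \<open>z1\<close> also maximizes \<open>F\<close>
        over \<open>U\<close>.\<close>
      define W where "W = ({0<..<T} \<times> \<Omega>) \<inter> V'"
      define U where "U = W \<inter> u -` {- m0<..<m0}"
      have W: "open W" "W \<subseteq> \<Theta>'"
        using domain(1) V' by (auto simp: W_def open_Times)
      have "open U"
        unfolding U_def using W Theta'(3)
        by (intro continuous_open_preimage continuous_on_subset[OF u_cont]) auto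
      moreover have "z1 \<in> U"
        using strict z1(1) \<Gamma>_sub V' by (cases z1) (auto simp: U_def W_def)
      moreover have "U \<subseteq> {0<..<T} \<times> \<Omega>"
        by (auto simp: U_def W_def)
      moreover have U_\<Gamma>: "U \<subseteq> \<Gamma>"
        using W closure_subset[of \<Theta>'] by (fastforce simp: U_def W_def \<Gamma>_iff)
      then have "GDERIV \<phi> y :> g y" if "y \<in> U" for y
        using that \<Gamma>_sub by (intro gd) (auto simp: U_def W_def)
      moreover have "continuous_on U g"
        using continuous_on_subset[OF g_cont] U_\<Gamma> \<Gamma>_sub by blast
      moreover have "z1 \<in> \<Theta>" "z1 \<in> time_part \<Theta> {0..T}" "z1 \<in> time_part \<Theta>' {0..T}"
        using z1(1) \<Gamma>_sub m0(2) by (auto simp: time_part_def)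
      moreover have "z1 \<in> {0..} \<times> closure \<Omega>"
        using \<open>z1 \<in> \<Theta>\<close> \<Theta>_sub closure_subset by auto
      ultimately have "F z1 \<le> 0"
        unfolding F_def
        using V0(2) \<sigma> \<open>K > 0\<close> m0(1) \<open>n > 0\<close> strict(1) z1(2)[unfolded F_def] U_\<Gamma>
        by (intro tube_comparison_interior_max[OF visc, of U _ B _ g V0 "C * exp (- V0 * fst z1)"]
            B eqn Lip \<beta>) auto
      with \<open>\<not> F z1 \<le> 0\<close> show False
        by simp
    qed
    then show ?thesis
      using z1(2)[OF \<open>z \<in> \<Gamma>\<close>] by (simp add: F_def)
  qed

  \<comment> \<open>Limit of large exponents\<close>
  have eq_inner: "\<phi>v z = \<phi> z" if z: "z \<in> \<Gamma>" "\<bar>u z\<bar> < m0" "fst z < T" for z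
  proof -
    have "(\<lambda>n. ((u z / m0)\<^sup>2) ^ n) \<longlonglongrightarrow> 0"
    proof (rule LIMSEQ_power_zero)
      have "\<bar>u z / m0\<bar> < 1"
        using z m0(1) by (simp add: divide_less_eq)
      then show "norm ((u z / m0)\<^sup>2) < 1"
        by (simp add: abs_square_less_1)
    qed
    moreover have "(\<lambda>n. (fst z / T) ^ n) \<longlonglongrightarrow> 0"
      using z T by (intro LIMSEQ_power_zero) (auto simp: \<Gamma>_iff)
    ultimately have "(\<lambda>n. K * (((u z / m0)\<^sup>2) ^ n + (fst z / T) ^ n)) \<longlonglongrightarrow> K * (0 + 0)"
      by (intro tendsto_mult tendsto_add tendsto_const)
    then have lim: "(\<lambda>n. K * tube_barrier T m0 n \<beta> \<phi> z) \<longlonglongrightarrow> 0"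
      by (simp add: tube_barrier_def u_eq power_mult)
    \<comment> \<open>The barrier bound is available from \<open>n = 1\<close> on; the two signs
      together give equality.\<close>
    have "\<sigma> * exp (- V0 * fst z) * (\<phi>v z - \<phi> z) \<le> 0" if "\<sigma> \<in> {1, -1}" for \<sigma>
      using below_barrier[OF that _ z(1)] by (intro LIMSEQ_le_const[OF lim]) (auto intro!: exI[of _ 1])
    from this[of 1] this[of "-1"] show ?thesis
      by (simp add: mult_le_0_iff zero_le_mult_iff)
  qed

  \<comment> \<open>Extension to the final time and the walls by density\<close>
  define \<Gamma>1 where "\<Gamma>1 = {z \<in> \<Gamma>. \<bar>u z\<bar> < m0}"
  define \<Gamma>0 where "\<Gamma>0 = {z \<in> \<Gamma>1. fst z < T}"
  have "\<Gamma>1 \<subseteq> closure \<Gamma>0"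
  proof
    fix z assume z: "z \<in> \<Gamma>1"
    show "z \<in> closure \<Gamma>0"
    proof (cases "fst z < T")
      case True
      then show ?thesis
        using z closure_subset[of \<Gamma>0] by (auto simp: \<Gamma>0_def)
    next
      case False
      then obtain x where x: "z = (T, x)"
        using z by (cases z) (auto simp: \<Gamma>1_def \<Gamma>_iff)
      \<comment> \<open>Openness relative to \<open>{0..} \<times> \<Omega>\<close> allows moving
        backwards in time from \<open>(T, x)\<close> at fixed \<open>x\<close> without leaving the
        tube.\<close>
      have "openin (top_of_set \<Theta>') (\<Theta>' \<inter> u -` {- m0<..<m0})"
        using continuous_on_subset[OF u_cont Theta'(3)] by (intro continuous_openin_preimage_gen) auto
      then have "openin (top_of_set ({0..} \<times> \<Omega>)) (\<Theta>' \<inter> u -` {- m0<..<m0})"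
        using Theta'(2) openin_trans by blast
      then obtain O' where O': "open O'" "\<Theta>' \<inter> u -` {- m0<..<m0} = ({0..} \<times> \<Omega>) \<inter> O'"
        by (auto simp: openin_open)
      have "z \<in> \<Theta>' \<inter> u -` {- m0<..<m0}"
        using z \<Gamma>_sub by (auto simp: \<Gamma>1_def)
      then have "z \<in> O'" "x \<in> \<Omega>"
        unfolding O' x by auto
      have "((\<lambda>s. (s, x)) \<longlongrightarrow> (T, x)) (at_left T)"
        by (intro tendsto_intros)
      moreover have "\<forall>\<^sub>F s in at_left T. (s, x) \<in> \<Gamma>0"
      proof -
        have "\<forall>\<^sub>F s in at_left T. (s, x) \<in> O'"
          using topological_tendstoD[OF calculation O'(1)] \<open>z \<in> O'\<close> x by simp
        moreover have "\<forall>\<^sub>F s in at_left T. s \<in> {0<..<T}"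
          using T by (intro eventually_at_leftI[of 0]) auto
        ultimately show ?thesis
        proof eventually_elim
          case (elim s)
          then have "(s, x) \<in> \<Theta>' \<inter> u -` {- m0<..<m0}"
            unfolding O' using \<open>x \<in> \<Omega>\<close> by auto
          then show ?case
            using elim closure_subset[of \<Theta>'] by (auto simp: \<Gamma>0_def \<Gamma>1_def \<Gamma>_iff)
        qed
      qed
      then have "\<forall>\<^sub>F s in at_left T. (s, x) \<in> closure \<Gamma>0"
        by eventually_elim (use closure_subset in blast)
      ultimately show ?thesis
        unfolding x by (intro Lim_in_closed_set[of "closure \<Gamma>0" _ "at_left T"]) auto
    qed
  qed
  moreover have "\<Gamma> \<subseteq> closure \<Gamma>1"
  proof (rule subsetI, rule ccontr)
    fix z assume z: "z \<in> \<Gamma>" "z \<notin> closure \<Gamma>1"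
    obtain t x where tx: "z = (t, x)"
      by (cases z)
    have "z \<in> \<Theta>" "z \<in> V'" "x \<in> \<Omega>"
      using z \<Gamma>_sub V' tx by auto
    have uz: "\<bar>u z\<bar> = m0"
      using z closure_subset[of \<Gamma>1] by (fastforce simp: \<Gamma>1_def \<Gamma>_iff)
    txt \<open>Otherwise \<open>(\<phi> (t, -))\<^sup>2\<close> has a local minimum at \<open>x\<close>, where neither \<open>\<phi>\<close> nor its gradient vanishes.\<close>
    define S where "S = \<Omega> \<inter> (\<lambda>y. (t, y)) -` (V' - closure \<Gamma>1)"
    have "open S"
      unfolding S_def using domain(1) V' by (intro open_Int open_vimage continuous_intros open_Diff) auto
    moreover have "x \<in> S"
      using z \<open>z \<in> V'\<close> \<open>x \<in> \<Omega>\<close> tx by (simp add: S_def)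
    moreover have "((\<lambda>y. (\<phi> (t, y))\<^sup>2) has_derivative (\<lambda>h. 2 * \<phi> z * (h \<bullet> snd (g z)))) (at x)"
      using has_derivative_power[OF slice, of t x 2] \<open>z \<in> \<Theta>\<close> by (simp add: tx mult_ac)
    \<comment> \<open>At the fixed time \<open>t\<close>, \<open>u\<close> is a positive constant
      multiple of \<open>\<phi>\<close>, so \<open>|u| \<ge> m0 = |u z|\<close> off
      \<open>\<Gamma>1\<close> carries over to \<open>\<phi>\<close>.\<close>
    moreover have "(\<phi> (t, x))\<^sup>2 \<le> (\<phi> (t, y))\<^sup>2" if "y \<in> S" for y
    proof -
      have "(t, y) \<in> \<Theta>'" "(t, y) \<notin> \<Gamma>1"
        using that V' z closure_subset[of \<Gamma>1] by (auto simp: S_def tx \<Gamma>_iff)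
      then have "m0 \<le> \<bar>u (t, y)\<bar>"
        using z closure_subset[of \<Theta>'] by (auto simp: \<Gamma>1_def \<Gamma>_iff tx)
      then have "\<bar>\<phi> (t, x)\<bar> \<le> \<bar>\<phi> (t, y)\<bar>"
        unfolding uz[symmetric] by (simp add: tx u_eq abs_mult)
      then show ?thesis
        by (simp add: abs_le_square_iff)
    qed
    ultimately have "(\<lambda>h. 2 * \<phi> z * (h \<bullet> snd (g z))) = (\<lambda>h. 0)"
      by (intro differential_zero_maxmin[of x S "\<lambda>y. (\<phi> (t, y))\<^sup>2"]) auto
    from fun_cong[OF this, of "snd (g z)"] have "\<phi> z = 0 \<or> snd (g z) = 0"
      by simp
    moreover have "\<phi> z \<noteq> 0"
      using uz m0(1) by (auto simp: u_eq)
    moreover have "snd (g z) \<noteq> 0"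
      using phi(1) \<open>z \<in> \<Theta>\<close> gradx_\<phi>[OF \<open>z \<in> \<Theta>\<close>] by (auto simp: classical_solution_def)
    ultimately show False
      by simp
  qed
  \<comment> \<open>By continuity the coincidence set is closed in the compact
    \<open>\<Gamma>\<close>, so it contains the closure of \<open>\<Gamma>0\<close>, and with it
    \<open>\<Gamma>1\<close> and all of \<open>\<Gamma>\<close>.\<close>
  moreover have "closure \<Gamma>0 \<subseteq> {z \<in> \<Gamma>. \<phi> z - \<phi>v z = 0}"
  proof (rule closure_minimal)
    show "\<Gamma>0 \<subseteq> {z \<in> \<Gamma>. \<phi> z - \<phi>v z = 0}"
      using eq_inner by (auto simp: \<Gamma>0_def \<Gamma>1_def)
    show "closed {z \<in> \<Gamma>. \<phi> z - \<phi>v z = 0}"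
      using diff_cont \<open>compact \<Gamma>\<close>
      by (intro continuous_closed_preimage_constant continuous_intros compact_imp_closed)
  qed
  ultimately show ?thesis
    using closure_minimal[of \<Gamma>1 "closure \<Gamma>0"] by fastforce
qed

end
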